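(* Let $W:J\times J\to[0,1]$ be a graphon. For any $p\in[1,\infty]$ and $r\in[1,\infty)$, $$2^{1-r}\,c_2(\Phi_{pr},\widetilde{\llbracket\cdot\rrbracket}_{pr})^r\le c_2(\Phi_p,\widetilde{\llbracket\cdot\rrbracket}_p)\le r\cdot c_2(\Phi_{pr},\widetilde{\llbracket\cdot\rrbracket}_{pr}).$$
   Context: $J$ is a measure space with finite positive measure (written $dx$); a graphon is a symmetric measurable function $W:J\times J\to[0,1]$; $\deg(x)=\int_JW(x,y)\,dy$; $\mathrm{Bd}$ is the space of bounded measurable functions $J\to\mathbb{R}$. Here $\Phi_p(f)=\big(\int_J\int_JW(x,y)|f(x)-f(y)|^p\,dx\,dy\big)^{1/p}$, $\widetilde{\llbracket f\rrbracket}_p=\big(\int_J\deg(x)|f(x)|^p\,dx\big)^{1/p}$, and the constant $c_2$ is given by $$c_2(\Phi_p,\widetilde{\llbracket\cdot\rrbracket}_p)=\inf_{f\in\mathrm{Bd}\text{ nonconstant}}\left(\frac{\int_J\int_JW(x,y)|f(x)-f(y)|^p\,dx\,dy}{\min_{t\in\mathbb{R}}\int_J\deg(x)|f(x)-t|^p\,dx}\right)^{1/p},$$ the infimum being over $f$ with positive denominator. For $p=\infty$ the $L^p$ expressions are replaced by the essential suprema with respect to the measures $W(x,y)\,dx\,dy$ and $\deg(x)\,dx$. *)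

theory Defs
  imports "HOL-Analysis.Analysis" "HOL-Probability.Essential_Supremum"
begin

definition graphon :: "'a measure \<Rightarrow> ('a \<Rightarrow> 'a \<Rightarrow> real) \<Rightarrow> bool" where
  "graphon M W \<longleftrightarrow>
     (\<lambda>(x, y). W x y) \<in> borel_measurable (M \<Otimes>\<^sub>M M) \<and>
     (\<forall>x\<in>space M. \<forall>y\<in>space M. W x y = W y x) \<and>
     (\<forall>x\<in>space M. \<forall>y\<in>space M. 0 \<le> W x y \<and> W x y \<le> 1)"

definition deg :: "'a measure \<Rightarrow> ('a \<Rightarrow> 'a \<Rightarrow> real) \<Rightarrow> 'a \<Rightarrow> real" where
  "deg M W x = (LINT y|M. W x y)"

definition Bd :: "'a measure \<Rightarrow> ('a \<Rightarrow> real) set" where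
  "Bd M = {f \<in> borel_measurable M. bounded (f ` space M)}"

text \<open>
  The exponent \<open>p\<close> ranges over \<open>[1, \<infinity>]\<close>, represented in \<^typ>\<open>ennreal\<close>.
  The essential suprema are taken in \<^typ>\<open>ennreal\<close>, so that they are \<open>0\<close> for the zero measure;
  they are finite for \<open>f \<in> Bd M\<close>.
\<close>

definition Phi :: "'a measure \<Rightarrow> ('a \<Rightarrow> 'a \<Rightarrow> real) \<Rightarrow> ennreal \<Rightarrow> ('a \<Rightarrow> real) \<Rightarrow> real" where
  "Phi M W p f =
     (if p = \<infinity>
      then enn2real (esssup (density (M \<Otimes>\<^sub>M M) (\<lambda>(x, y). ennreal (W x y)))
                            (\<lambda>(x, y). ennreal \<bar>f x - f y\<bar>))
      else (LINT x|M. LINT y|M. W x y * \<bar>f x - f y\<bar> powr enn2real p) powr (1 / enn2real p))"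

definition deg_norm :: "'a measure \<Rightarrow> ('a \<Rightarrow> 'a \<Rightarrow> real) \<Rightarrow> ennreal \<Rightarrow> ('a \<Rightarrow> real) \<Rightarrow> real" where
  "deg_norm M W p f =
     (if p = \<infinity>
      then enn2real (esssup (density M (\<lambda>x. ennreal (deg M W x))) (\<lambda>x. ennreal \<bar>f x\<bar>))
      else (LINT x|M. deg M W x * \<bar>f x\<bar> powr enn2real p) powr (1 / enn2real p))"

text \<open>
  The distance from \<open>f\<close> to the constants, written as an infimum. For the seminorms above and
  \<open>f \<in> Bd M\<close> it is a minimum: \<open>t \<mapsto> N (f - t)\<close> is continuous, and either coercive or
  identically \<open>0\<close>.
\<close>

definition dist_const :: "(('a \<Rightarrow> real) \<Rightarrow> real) \<Rightarrow> ('a \<Rightarrow> real) \<Rightarrow> real" where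
  "dist_const N f = (INF t. N (\<lambda>x. f x - t))"

text \<open>
  The Poincare-type constant of a pair of functionals. It is \<^typ>\<open>ennreal\<close>-valued, since it is
  the infimum of the empty set, that is \<open>\<infinity>\<close>, when no admissible \<open>f\<close> exists
  (for instance when \<open>W = 0\<close>).
\<close>

definition c2 :: "'a measure \<Rightarrow> (('a \<Rightarrow> real) \<Rightarrow> real) \<Rightarrow> (('a \<Rightarrow> real) \<Rightarrow> real) \<Rightarrow> ennreal" where
  "c2 M \<Phi> N =
     (INF f\<in>{f \<in> Bd M. \<not> f constant_on space M \<and> 0 < dist_const N f}.
        ennreal (\<Phi> f / dist_const N f))"

text \<open>Real powers on \<open>[0, \<infinity>]\<close>; used only for exponents \<open>r > 0\<close>.\<close>

definition ennreal_powr :: "ennreal \<Rightarrow> real \<Rightarrow> ennreal" where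
  "ennreal_powr x r = (if x = \<infinity> then \<infinity> else ennreal (enn2real x powr r))"

lemma powr_cINF:
  fixes D :: "'b \<Rightarrow> real"
  assumes "A \<noteq> {}" "\<And>t. 0 \<le> D t" "0 < q"
  shows "(INF t\<in>A. D t powr q) = (INF t\<in>A. D t) powr q"
proof -
  have ne: "D ` A \<noteq> {}" and bdd: "bdd_below (D ` A)"
    using assms by (auto intro!: bdd_belowI[of _ 0])
  have nn: "0 \<le> (INF t\<in>A. D t)"
    using assms by (auto intro: cINF_greatest)
  let ?g = "\<lambda>x::real. max 0 x powr q"
  have "mono ?g"
    using assms(3) by (intro monoI powr_mono2) auto
  moreover have "continuous (at_right (Inf (D ` A))) ?g"
    unfolding continuous_within using assms(3)
    by (intro tendsto_powr' tendsto_intros) auto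
  ultimately have "?g (Inf (D ` A)) = (INF s\<in>D ` A. ?g s)"
    using ne bdd by (rule continuous_at_Inf_mono)
  also have "\<dots> = (INF t\<in>A. D t powr q)"
    using assms(2) by (simp add: image_image max_absorb2)
  finally show ?thesis
    using nn by (simp add: max_absorb2)
qed

text \<open>The explicit formula for the constant when \<open>p\<close> is finite.\<close>

lemma c2_Phi_deg_norm:
  fixes p :: real
  assumes W: "graphon M W" and p: "1 \<le> p"
  defines "E \<equiv> \<lambda>f. LINT x|M. LINT y|M. W x y * \<bar>f x - f y\<bar> powr p"
  defines "D \<equiv> \<lambda>f. INF t. LINT x|M. deg M W x * \<bar>f x - t\<bar> powr p"
  shows "c2 M (Phi M W (ennreal p)) (deg_norm M W (ennreal p)) =
    (INF f\<in>{f \<in> Bd M. \<not> f constant_on space M \<and> 0 < D f}. ennreal ((E f / D f) powr (1 / p)))"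
proof -
  have W0: "0 \<le> W x y" if "x \<in> space M" "y \<in> space M" for x y
    using W that by (auto simp: graphon_def)
  then have deg0: "0 \<le> deg M W x" if "x \<in> space M" for x
    unfolding deg_def using that by (intro Bochner_Integration.integral_nonneg) auto
  have int0: "0 \<le> (LINT x|M. deg M W x * \<bar>f x - t\<bar> powr p)" for f t
    using deg0 by (intro Bochner_Integration.integral_nonneg) auto
  have E0: "0 \<le> E f" for f
    unfolding E_def using W0 by (intro Bochner_Integration.integral_nonneg) auto
  have D0: "0 \<le> D f" for f
    unfolding D_def using int0 by (auto intro: cINF_greatest)
  have dist: "dist_const (deg_norm M W (ennreal p)) f = D f powr (1 / p)" for f
    unfolding dist_const_def D_def deg_norm_def
    using p int0 by (subst powr_cINF[symmetric]) auto
  have Phi: "Phi M W (ennreal p) f = E f powr (1 / p)" for f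
    using p by (simp add: Phi_def E_def)
  have "0 < D f powr (1 / p) \<longleftrightarrow> 0 < D f" for f
    using D0[of f] by auto
  then show ?thesis
    unfolding c2_def dist Phi using E0 D0 by (simp add: powr_divide)
qed

end

theory Submission
  imports Defs
begin

text \<open>
  Let \<open>\<phi>\<^sub>k(s) = sgn(s)\<bar>s\<bar>\<^sup>k\<close>. For finite \<open>p\<close>, a test function \<open>f\<close> for one exponent is turned into the
  test function \<open>\<phi>\<^sub>k(f - u)\<close> for the other, with \<open>k = 1/r\<close> or \<open>k = r\<close>. The shift \<open>u\<close> is chosen so
  that the constant nearest to \<open>\<phi>\<^sub>k(f - u)\<close> is \<open>0\<close>; then its distance to the constants is the
  corresponding power of a norm of \<open>f - u\<close>, which dominates the distance of \<open>f\<close> to the constants.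
  The energies are compared by \<open>\<bar>x - y\<bar>\<^sup>r \<le> 2\<^sup>r\<^sup>-\<^sup>1 \<bar>\<phi>\<^sub>r(x) - \<phi>\<^sub>r(y)\<bar>\<close> and by
  \<open>\<bar>\<phi>\<^sub>r(a) - \<phi>\<^sub>r(b)\<bar> \<le> r \<bar>a - b\<bar> ((\<bar>a\<bar>\<^sup>r + \<bar>b\<bar>\<^sup>r) / 2)\<^bsup>1 - 1/r\<^esup>\<close> with Hoelder's inequality.
  For \<open>p = \<infinity>\<close> both constants coincide, and the claim amounts to \<open>c\<^sub>2 \<le> 2\<close>.
\<close>

section \<open>Signed powers: algebra, continuity and derivative\<close>

definition spow :: "real \<Rightarrow> real \<Rightarrow> real" where
  "spow k s = sgn s * \<bar>s\<bar> powr k"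

lemma spow_nonneg: "0 \<le> s \<Longrightarrow> 0 \<le> spow k s"
  and spow_nonpos: "s \<le> 0 \<Longrightarrow> spow k s \<le> 0"
  by (auto simp: spow_def sgn_if)

lemma abs_spow: "\<bar>spow k s\<bar> = \<bar>s\<bar> powr k"
  by (auto simp: spow_def abs_mult sgn_if)

lemma spow_minus: "spow k (- s) = - spow k s"
  by (simp add: spow_def sgn_minus)

lemma spow_spow: "spow a (spow b s) = spow (a * b) s"
  by (auto simp: spow_def sgn_mult abs_mult sgn_if powr_powr mult.commute)

lemma spow_one [simp]: "spow 1 s = s"
  by (simp add: spow_def sgn_mult_abs)

text \<open>This form makes continuity for \<open>0 < k\<close> visible: both terms are positive
  powers of continuous nonnegative functions.\<close>

lemma spow_eq: "spow k s = (max 0 s) powr k - (max 0 (- s)) powr k"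
  by (auto simp: spow_def sgn_if max_def)

lemma continuous_on_spow:
  "0 < k \<Longrightarrow> continuous_on S f \<Longrightarrow> continuous_on S (\<lambda>x. spow k (f x))"
  unfolding spow_eq by (intro continuous_intros continuous_on_powr') auto

lemma borel_measurable_spow [measurable]: "spow k \<in> borel_measurable borel"
  unfolding spow_def[abs_def] by measurable

text \<open>For \<open>s > 0\<close> this is the ordinary power rule, and oddness transfers it to
  \<open>s < 0\<close>. At \<open>0\<close> the difference quotient is
  \<open>\<bar>h\<bar> powr (k - 1)\<close>, which tends to \<open>0\<close> because
  \<open>k > 1\<close>.\<close>

lemma has_real_derivative_spow:
  assumes "1 < k"
  shows "(spow k has_real_derivative k * \<bar>s\<bar> powr (k - 1)) (at s)"
proof -
  have pos: "(spow k has_real_derivative k * \<bar>s\<bar> powr (k - 1)) (at s)" if "0 < s" for s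
  proof -
    have "((\<lambda>s. s powr k) has_real_derivative k * \<bar>s\<bar> powr (k - 1)) (at s)"
      using that by (auto intro!: derivative_eq_intros)
    then show ?thesis
      by (rule has_field_derivative_transform_within_open[of _ _ _ "{0<..}"])
        (use that in \<open>auto simp: spow_def\<close>)
  qed
  consider "0 < s" | "s < 0" | "s = 0" by linarith
  then show ?thesis
  proof cases
    case 1
    then show ?thesis by (rule pos)
  next
    case 2
    then have "((\<lambda>s. spow k (- s)) has_real_derivative - (k * \<bar>s\<bar> powr (k - 1))) (at s)"
      using pos[of "- s"] by (subst DERIV_mirror[symmetric]) simp
    then show ?thesis
      using DERIV_minus by (fastforce simp: spow_minus)
  next
    case 3
    have "((\<lambda>h. \<bar>h\<bar> powr (k - 1)) \<longlongrightarrow> \<bar>0\<bar> powr (k - 1)) (at (0::real))"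
      using assms by (intro tendsto_powr' tendsto_intros) auto
    moreover have "\<bar>h\<bar> powr (k - 1) = spow k h / h" if "h \<noteq> 0" for h :: real
      using that by (auto simp: spow_def powr_diff sgn_if)
    ultimately have "((\<lambda>h. spow k h / h) \<longlongrightarrow> 0) (at 0)"
      by (auto elim!: Lim_transform_eventually simp: eventually_at_filter)
    then show ?thesis
      using 3 by (simp add: DERIV_def spow_def)
  qed
qed

section \<open>Pointwise inequalities for powers and signed powers\<close>

lemma convex_on_abs_powr:
  fixes k :: real
  assumes "1 \<le> k"
  shows "convex_on UNIV (\<lambda>x::real. \<bar>x\<bar> powr k)"
proof (rule convex_onI)
  fix t x y :: real
  assume t: "0 < t" "t < 1"
  \<comment> \<open>Convexity of \<open>powr\<close> is applied to positive arguments only. If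
    \<open>x\<close> or \<open>y\<close> is \<open>0\<close>, the claim reduces to this inequality,
    which comes from \<open>u powr k \<le> u\<close> on the unit interval.\<close>
  have small: "(u * z) powr k \<le> u * z powr k" if "0 < u" "u < 1" "0 \<le> z" for u z :: real
    using that assms powr_le_one_le[of u k] by (auto simp: powr_mult intro!: mult_right_mono)
  have "\<bar>(1 - t) * x + t * y\<bar> \<le> (1 - t) * \<bar>x\<bar> + t * \<bar>y\<bar>"
    using t abs_triangle_ineq[of "(1 - t) * x" "t * y"] by (simp add: abs_mult)
  then have "\<bar>(1 - t) * x + t * y\<bar> powr k \<le> ((1 - t) * \<bar>x\<bar> + t * \<bar>y\<bar>) powr k"
    using assms by (intro powr_mono2) auto
  also have "\<dots> \<le> (1 - t) * \<bar>x\<bar> powr k + t * \<bar>y\<bar> powr k"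
  proof (cases "x = 0 \<or> y = 0")
    case True
    then show ?thesis using small[of t "\<bar>y\<bar>"] small[of "1 - t" "\<bar>x\<bar>"] t by auto
  next
    case False
    then show ?thesis
      using convex_onD[OF powr_convex[OF assms], of t "\<bar>x\<bar>" "\<bar>y\<bar>"] t by simp
  qed
  finally show "\<bar>(1 - t) *\<^sub>R x + t *\<^sub>R y\<bar> powr k \<le> (1 - t) * \<bar>x\<bar> powr k + t * \<bar>y\<bar> powr k"
    by simp
qed simp

lemma powr_mean_le:
  fixes x y k :: real
  assumes "1 \<le> k"
  shows "\<bar>(x + y) / 2\<bar> powr k \<le> (\<bar>x\<bar> powr k + \<bar>y\<bar> powr k) / 2"
  using convex_onD[OF convex_on_abs_powr[OF assms], of "1 / 2" x y] by (simp add: add_divide_distrib)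

text \<open>After division by \<open>x + y\<close> the two arguments are weights with sum
  \<open>1\<close>, and \<open>u powr k \<le> u\<close> holds for each weight.\<close>

lemma powr_add_le:
  fixes x y k :: real
  assumes "1 \<le> k" "0 \<le> x" "0 \<le> y"
  shows "x powr k + y powr k \<le> (x + y) powr k"
proof (cases "x = 0 \<or> y = 0")
  case False
  then have pos: "0 < x" "0 < y" using assms by auto
  have "(x / (x + y)) powr k + (y / (x + y)) powr k \<le> x / (x + y) + y / (x + y)"
    using pos assms by (intro add_mono powr_le_one_le) auto
  also have "\<dots> = 1" using pos by (simp flip: add_divide_distrib)
  finally show ?thesis
    using pos by (simp add: powr_divide field_simps flip: add_divide_distrib)
qed (use assms in auto)

text \<open>For arguments of equal sign, superadditivity of \<open>powr\<close> gives the bound even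
  with constant \<open>1\<close>. For opposite signs the right-hand difference is
  \<open>\<bar>x\<bar> powr r + \<bar>y\<bar> powr r\<close>, and convexity at the midpoint gives
  the factor, with equality at \<open>y = - x\<close>.\<close>

lemma abs_diff_powr_le_spow:
  assumes "1 \<le> r"
  shows "\<bar>x - y\<bar> powr r \<le> 2 powr (r - 1) * \<bar>spow r x - spow r y\<bar>"
proof -
  have same: "\<bar>x - y\<bar> powr r \<le> 2 powr (r - 1) * \<bar>spow r x - spow r y\<bar>"
    if "0 \<le> y" "y \<le> x" for x y
  proof -
    have "(x - y) powr r + y powr r \<le> x powr r"
      using powr_add_le[OF assms, of "x - y" y] that by simp
    then have "\<bar>x - y\<bar> powr r \<le> \<bar>spow r x - spow r y\<bar>"
      using that by (auto simp: spow_def sgn_if)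
    also have "\<dots> \<le> 2 powr (r - 1) * \<bar>spow r x - spow r y\<bar>"
      using assms by (intro mult_le_cancel_right1[THEN iffD2]) (auto intro: ge_one_powr_ge_zero)
    finally show ?thesis .
  qed
  have opp: "\<bar>x - y\<bar> powr r \<le> 2 powr (r - 1) * \<bar>spow r x - spow r y\<bar>"
    if "y \<le> 0" "0 \<le> x" for x y
  proof -
    have "\<bar>x - y\<bar> powr r = 2 powr r * \<bar>(x + (- y)) / 2\<bar> powr r"
      by (simp add: powr_divide)
    also have "\<dots> \<le> 2 powr r * ((\<bar>x\<bar> powr r + \<bar>- y\<bar> powr r) / 2)"
      by (intro mult_left_mono powr_mean_le assms) auto
    also have "\<dots> = 2 powr (r - 1) * (\<bar>x\<bar> powr r + \<bar>y\<bar> powr r)"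
      by (simp add: powr_diff)
    also have "\<bar>x\<bar> powr r + \<bar>y\<bar> powr r = \<bar>spow r x - spow r y\<bar>"
      using that by (auto simp: spow_def sgn_if)
    finally show ?thesis .
  qed
  consider "0 \<le> y" "y \<le> x" | "0 \<le> x" "x \<le> y" | "y \<le> 0" "0 \<le> x" | "x \<le> 0" "0 \<le> y"
    | "y \<le> 0" "x \<le> y" | "x \<le> 0" "y \<le> x"
    by linarith
  then show ?thesis
    using same[of y x] same[of x y] opp[of y x] opp[of x y]
      same[of "- y" "- x"] same[of "- x" "- y"]
    by cases (auto simp: spow_minus abs_minus_commute)
qed

text \<open>Young's inequality with weights \<open>(r - 1) / r\<close> and \<open>1 / r\<close> for
  \<open>s powr r\<close> and \<open>l powr r\<close>, multiplied by \<open>r\<close>. Equality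
  holds at \<open>s = l\<close>.\<close>

lemma Young_powr:
  fixes l s r :: real
  assumes "1 < r" "0 < l" "0 \<le> s"
  shows "l * (r * s powr (r - 1)) \<le> (r - 1) * s powr r + l powr r"
proof (cases "s = 0")
  case False
  have "(s powr r) powr ((r - 1) / r) * (l powr r) powr (1 / r)
      \<le> (r - 1) / r * s powr r + 1 / r * l powr r"
    using assms False by (intro Youngs_inequality_0) (auto simp: field_simps)
  moreover have "(s powr r) powr ((r - 1) / r) = s powr (r - 1)" "(l powr r) powr (1 / r) = l"
    using assms by (auto simp: powr_powr)
  ultimately show ?thesis
    using assms by (simp add: field_simps)
qed simp

text \<open>
  The bound \<open>r * \<bar>a - b\<bar> * max \<bar>a\<bar> \<bar>b\<bar> powr (r - 1)\<close> would be too weak: after integration it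
  loses a power of 2. Bounding \<open>\<bar>s\<bar> powr r\<close> by its chord on \<open>[b, a]\<close> gives the average of the
  endpoint values, whose \<open>W\<close>-integral is exactly the degree-weighted one.
\<close>

lemma abs_spow_diff_le:
  assumes "1 \<le> r"
  shows "\<bar>spow r a - spow r b\<bar>
    \<le> r * \<bar>a - b\<bar> * ((\<bar>a\<bar> powr r + \<bar>b\<bar> powr r) / 2) powr ((r - 1) / r)"
proof (cases "r = 1 \<or> a = b")
  case True
  \<comment> \<open>For \<open>r = 1\<close> the last factor has exponent \<open>0\<close>, and
    \<open>0 powr 0 = 0\<close> makes it vanish when \<open>a\<close> and \<open>b\<close> are both
    \<open>0\<close>; then the left side is \<open>0\<close> as well.\<close>
  moreover have "\<bar>a\<bar> + \<bar>b\<bar> = 0 \<Longrightarrow> a = b" by linarith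
  ultimately show ?thesis by auto
next
  case False
  then have r: "1 < r" using assms by auto
  have *: "spow r a - spow r b
      \<le> r * (a - b) * ((\<bar>a\<bar> powr r + \<bar>b\<bar> powr r) / 2) powr ((r - 1) / r)" if ba: "b < a" for a b
  proof -
    define S where "S = (\<bar>a\<bar> powr r + \<bar>b\<bar> powr r) / 2"
    \<comment> \<open>The free parameter of \<open>Young_powr\<close>, chosen with
      \<open>l powr r = S\<close> so that the bound integrates to a multiple of the endpoint average
      \<open>S\<close>.\<close>
    define l where "l = S powr (1 / r)"
    define k where "k = (\<bar>a\<bar> powr r - \<bar>b\<bar> powr r) / (a - b)"
    have k: "k * (a - b) = \<bar>a\<bar> powr r - \<bar>b\<bar> powr r" using ba by (simp add: k_def)
    have "0 < \<bar>a\<bar> powr r + \<bar>b\<bar> powr r"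
      using ba by (cases "a = 0") (auto intro: add_pos_nonneg)
    then have S: "0 < S" by (simp add: S_def)
    then have l: "0 < l" by (simp add: l_def)
    have lr: "l powr r = S" using S r by (simp add: l_def powr_powr)
    \<comment> \<open>An antiderivative of \<open>(r - 1)\<close> times the chord, plus
      \<open>S\<close>, minus \<open>l\<close> times the derivative of \<open>spow r\<close>. The
      chord bound and \<open>Young_powr\<close> make this derivative nonnegative on
      \<open>[b, a]\<close>.\<close>
    let ?F = "\<lambda>s. (r - 1) * (\<bar>b\<bar> powr r * s + k * (s - b)\<^sup>2 / 2) + S * s - l * spow r s"
    have chord: "\<bar>s\<bar> powr r \<le> \<bar>b\<bar> powr r + k * (s - b)" if "b \<le> s" "s \<le> a" for s
    proof -
      define t where "t = (s - b) / (a - b)"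
      have t: "0 \<le> t" "t \<le> 1" "t * (a - b) = s - b" using that ba by (auto simp: t_def)
      then have s: "s = (1 - t) * b + t * a" by (simp add: algebra_simps)
      have "\<bar>s\<bar> powr r \<le> (1 - t) * \<bar>b\<bar> powr r + t * \<bar>a\<bar> powr r"
        using convex_onD[OF convex_on_abs_powr[OF assms] t(1,2), of b a] by (simp add: s)
      also have "\<dots> = \<bar>b\<bar> powr r + t * (k * (a - b))" unfolding k by (simp add: algebra_simps)
      also have "t * (k * (a - b)) = k * (s - b)" using t(3) by (metis mult.left_commute)
      finally show ?thesis .
    qed
    have "?F b \<le> ?F a"
    proof (rule DERIV_nonneg_imp_nondecreasing[of b a ?F])
      fix s assume s: "b \<le> s" "s \<le> a"
      let ?d = "(r - 1) * (\<bar>b\<bar> powr r + k * (s - b)) + S - l * (r * \<bar>s\<bar> powr (r - 1))"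
      have "(?F has_real_derivative ?d) (at s)"
        by (auto intro!: derivative_eq_intros has_real_derivative_spow r simp: field_simps)
      moreover have "(r - 1) * \<bar>s\<bar> powr r \<le> (r - 1) * (\<bar>b\<bar> powr r + k * (s - b))"
        using r chord[OF s] by (intro mult_left_mono) auto
      then have "0 \<le> ?d" using Young_powr[OF r l, of "\<bar>s\<bar>"] lr by simp
      ultimately show "\<exists>y. DERIV ?F s :> y \<and> 0 \<le> y" by blast
    qed (use ba in simp)
    then have "l * (spow r a - spow r b)
        \<le> (r - 1) * (\<bar>b\<bar> powr r * (a - b) + k * (a - b) * (a - b) / 2) + S * (a - b)"
      by (simp add: algebra_simps power2_eq_square)
    \<comment> \<open>The integral of the chord is the trapezoid area \<open>(a - b) * S\<close>; it
      is counted \<open>r - 1\<close> times, and the term \<open>S * (a - b)\<close> adds one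
      more.\<close>
    also have "\<dots> = r * (a - b) * S" unfolding k S_def by (simp add: field_simps)
    also have "S = l * S powr ((r - 1) / r)"
      using S r by (simp add: l_def diff_divide_distrib flip: powr_add)
    finally have "l * (spow r a - spow r b) \<le> l * (r * (a - b) * S powr ((r - 1) / r))"
      by (simp add: algebra_simps)
    then show ?thesis using l by (simp add: S_def)
  qed
  have mono: "spow r b \<le> spow r a" if "b \<le> a" for a b
    using that r by (intro DERIV_nonneg_imp_nondecreasing[OF that])
      (auto intro!: exI has_real_derivative_spow)
  show ?thesis
    using *[of a b] *[of b a] mono[of a b] mono[of b a] False
    by (cases "b < a") (auto simp: add.commute)
qed

text \<open>The \<open>p\<close>-th power of \<open>abs_spow_diff_le\<close>, with \<open>p\<close>
  moved inside the mean by convexity. The exponents \<open>1 / r\<close> and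
  \<open>1 - 1 / r\<close> sum to \<open>1\<close>, which prepares Hoelder's inequality.\<close>

lemma abs_spow_diff_powr_le:
  assumes "1 \<le> r" "1 \<le> p"
  shows "\<bar>spow r a - spow r b\<bar> powr p
    \<le> r powr p * ((\<bar>a - b\<bar> powr (p * r)) powr (1 / r) *
        ((\<bar>a\<bar> powr (p * r) + \<bar>b\<bar> powr (p * r)) / 2) powr (1 - 1 / r))"
proof -
  let ?m = "(\<bar>a\<bar> powr r + \<bar>b\<bar> powr r) / 2"
  have "\<bar>spow r a - spow r b\<bar> powr p \<le> (r * \<bar>a - b\<bar> * ?m powr ((r - 1) / r)) powr p"
    using assms by (intro powr_mono2 abs_spow_diff_le) auto
  also have "\<dots> = r powr p * (\<bar>a - b\<bar> powr p * (?m powr p) powr (1 - 1 / r))"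
    using assms by (simp add: powr_mult powr_powr diff_divide_distrib mult_ac)
  also have "\<dots> \<le> r powr p * (\<bar>a - b\<bar> powr p *
        ((\<bar>a\<bar> powr (p * r) + \<bar>b\<bar> powr (p * r)) / 2) powr (1 - 1 / r))"
  proof (intro mult_left_mono powr_mono2)
    show "?m powr p \<le> (\<bar>a\<bar> powr (p * r) + \<bar>b\<bar> powr (p * r)) / 2"
      using powr_mean_le[OF assms(2), of "\<bar>a\<bar> powr r" "\<bar>b\<bar> powr r"]
      by (simp add: powr_powr mult.commute)
  qed (use assms in \<open>auto simp: field_simps\<close>)
  finally show ?thesis
    using assms by (simp add: powr_powr)
qed

section \<open>Centring by connectedness, and Hoelder's inequality\<close>

text \<open>
  Convexity says that \<open>0\<close> fails to minimise \<open>h u\<close> on at most one side, so the line is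
  covered by two closed sets of parameters, which meet by connectedness.
\<close>

lemma exists_centre:
  fixes h :: "real \<Rightarrow> real \<Rightarrow> real"
  assumes cont: "\<And>t. continuous_on UNIV (\<lambda>u. h u t)"
    and conv: "\<And>u. convex_on UNIV (h u)"
    and low: "\<exists>u. \<forall>t\<le>0. h u 0 \<le> h u t"
    and high: "\<exists>u. \<forall>t\<ge>0. h u 0 \<le> h u t"
  obtains u where "\<And>t. h u 0 \<le> h u t"
proof -
  define A where "A = (\<Inter>t\<in>{..0}. {u. h u 0 \<le> h u t})"
  define B where "B = (\<Inter>t\<in>{0..}. {u. h u 0 \<le> h u t})"
  have "closed A" "closed B"
    unfolding A_def B_def by (auto intro!: closed_INT closed_Collect_le cont)
  moreover have "u \<in> A \<union> B" for u
  proof (rule ccontr)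
    assume "u \<notin> A \<union> B"
    then obtain s t where st: "s \<le> 0" "h u s < h u 0" "0 \<le> t" "h u t < h u 0"
      unfolding A_def B_def by (auto simp: not_le)
    then have st0: "s < 0" "0 < t" by (metis order.irrefl order.not_eq_order_implies_strict)+
    define l where "l = - s / (t - s)"
    have l: "0 \<le> l" "l \<le> 1" using st0 by (auto simp: l_def divide_simps)
    have "l * (t - s) = - s" using st0 by (simp add: l_def)
    then have "(1 - l) * s + l * t = 0" by (simp add: algebra_simps)
    then have "h u 0 \<le> (1 - l) * h u s + l * h u t"
      using convex_onD[OF conv l, of s t u] by simp
    also have "\<dots> < h u 0"
      using convex_bound_lt[of "h u s" "h u 0" "h u t" "1 - l" l] st l by simp
    finally show False by simp
  qed
  moreover have "A \<noteq> {}" "B \<noteq> {}" using low high by (auto simp: A_def B_def)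
  ultimately obtain u where "u \<in> A" "u \<in> B"
    using connected_closedD[OF connected_UNIV, of A B] by auto
  then have "h u 0 \<le> h u t" for t
    by (cases "t \<le> 0") (auto simp: A_def B_def)
  then show ?thesis by (rule that)
qed

text \<open>Hoelder's inequality for conjugate exponents \<open>1 / \<theta>\<close> and
  \<open>1 / (1 - \<theta>)\<close>: both functions are divided by their integrals and Young's
  inequality is integrated. If one integral is \<open>0\<close>, the product vanishes almost
  everywhere.\<close>

lemma integral_geometric_mean_le:
  fixes A V :: "'a \<Rightarrow> real"
  assumes A: "integrable M A" "\<And>x. x \<in> space M \<Longrightarrow> 0 \<le> A x"
    and V: "integrable M V" "\<And>x. x \<in> space M \<Longrightarrow> 0 \<le> V x"
    and \<theta>: "0 \<le> \<theta>" "\<theta> \<le> 1"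
  shows "(LINT x|M. A x powr \<theta> * V x powr (1 - \<theta>))
    \<le> integral\<^sup>L M A powr \<theta> * integral\<^sup>L M V powr (1 - \<theta>)"
proof (cases "integral\<^sup>L M A = 0 \<or> integral\<^sup>L M V = 0")
  case True
  have "(AE x in M. A x = 0) \<or> (AE x in M. V x = 0)"
    using True A V integral_nonneg_eq_0_iff_AE[of M A] integral_nonneg_eq_0_iff_AE[of M V] by auto
  then have "AE x in M. A x powr \<theta> * V x powr (1 - \<theta>) = 0"
    by (elim disjE) (auto elim: eventually_mono)
  then have "(LINT x|M. A x powr \<theta> * V x powr (1 - \<theta>)) = 0"
    by (rule integral_eq_zero_AE)
  then show ?thesis by simp
next
  case False
  let ?Y = "integral\<^sup>L M A" and ?X = "integral\<^sup>L M V"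
  have pos: "0 < ?Y" "0 < ?X"
    using False A(2) V(2) by (auto simp: order_less_le intro!: Bochner_Integration.integral_nonneg)
  let ?c = "?Y powr \<theta> * ?X powr (1 - \<theta>)"
  have "(LINT x|M. A x powr \<theta> * V x powr (1 - \<theta>))
      \<le> (LINT x|M. ?c * (\<theta> / ?Y * A x + (1 - \<theta>) / ?X * V x))"
  proof (rule integral_mono_AE')
    show "AE x in M. A x powr \<theta> * V x powr (1 - \<theta>) \<le> ?c * (\<theta> / ?Y * A x + (1 - \<theta>) / ?X * V x)"
    proof (rule AE_I2)
      fix x assume x: "x \<in> space M"
      show "A x powr \<theta> * V x powr (1 - \<theta>) \<le> ?c * (\<theta> / ?Y * A x + (1 - \<theta>) / ?X * V x)"
      \<comment> \<open>A zero factor makes the left side \<open>0\<close>, even for exponent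
        \<open>0\<close>, since \<open>0 powr 0 = 0\<close>; Young's inequality treats the positive
        case.\<close>
      proof (cases "A x = 0 \<or> V x = 0")
        case True
        then show ?thesis using \<theta> A(2)[OF x] V(2)[OF x] pos by auto
      next
        case False
        then have AV: "0 < A x" "0 < V x" using A(2)[OF x] V(2)[OF x] by auto
        have "(A x / ?Y) powr \<theta> * (V x / ?X) powr (1 - \<theta>)
            \<le> \<theta> * (A x / ?Y) + (1 - \<theta>) * (V x / ?X)"
          using pos AV \<theta> by (intro Youngs_inequality_0) auto
        then have "?c * ((A x / ?Y) powr \<theta> * (V x / ?X) powr (1 - \<theta>))
            \<le> ?c * (\<theta> * (A x / ?Y) + (1 - \<theta>) * (V x / ?X))"
          by (rule mult_left_mono) simp
        then show ?thesis using pos by (simp add: powr_divide)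
      qed
    qed
    show "AE x in M. 0 \<le> ?c * (\<theta> / ?Y * A x + (1 - \<theta>) / ?X * V x)"
      using A V \<theta> pos by (intro AE_I2) auto
  qed (use A V in auto)
  also have "\<dots> = ?c * (\<theta> / ?Y * ?Y + (1 - \<theta>) / ?X * ?X)"
    using A V by simp
  also have "\<dots> = ?c" using pos by simp
  finally show ?thesis .
qed

section \<open>Closure properties of bounded measurable functions\<close>

lemma BdI: "f \<in> borel_measurable M \<Longrightarrow> (\<And>x. x \<in> space M \<Longrightarrow> \<bar>f x\<bar> \<le> C) \<Longrightarrow> f \<in> Bd M"
  unfolding Bd_def bounded_iff by auto

lemma BdE:
  assumes "f \<in> Bd M"
  obtains C where "0 \<le> C" "\<And>x. x \<in> space M \<Longrightarrow> \<bar>f x\<bar> \<le> C"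
proof -
  obtain C where "\<And>x. x \<in> space M \<Longrightarrow> \<bar>f x\<bar> \<le> C"
    using assms unfolding Bd_def bounded_iff by auto
  then show ?thesis
    by (intro that[of "max 0 C"]) (auto intro: max.coboundedI2)
qed

lemma Bd_measurable: "f \<in> Bd M \<Longrightarrow> f \<in> borel_measurable M"
  by (simp add: Bd_def)

text \<open>The values of \<open>f\<close> lie in a compact ball, whose image under
  \<open>\<phi>\<close> is again compact, hence bounded.\<close>

lemma Bd_continuous:
  assumes f: "f \<in> Bd M" and \<phi>: "continuous_on UNIV \<phi>"
  shows "(\<lambda>x. \<phi> (f x)) \<in> Bd M"
proof -
  obtain C where C: "\<And>x. x \<in> space M \<Longrightarrow> \<bar>f x\<bar> \<le> C" using BdE[OF f] by blast
  have "bounded (\<phi> ` cball 0 C)"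
    using \<phi> by (intro compact_imp_bounded compact_continuous_image) (auto intro: continuous_on_subset)
  moreover have "(\<lambda>x. \<phi> (f x)) ` space M \<subseteq> \<phi> ` cball 0 C" using C by auto
  ultimately have "bounded ((\<lambda>x. \<phi> (f x)) ` space M)" by (rule bounded_subset)
  moreover have "(\<lambda>x. \<phi> (f x)) \<in> borel_measurable M"
    using Bd_measurable[OF f] borel_measurable_continuous_onI[OF \<phi>] by measurable
  ultimately show ?thesis by (simp add: Bd_def)
qed

lemma Bd_powr: "f \<in> Bd M \<Longrightarrow> 1 \<le> p \<Longrightarrow> (\<lambda>x. \<bar>f x\<bar> powr p) \<in> Bd M"
  by (rule Bd_continuous[where \<phi> = "\<lambda>s. \<bar>s\<bar> powr p"])
    (auto intro!: continuous_on_powr' continuous_on_rabs continuous_on_id continuous_on_const)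

lemma Bd_diff_const: "f \<in> Bd M \<Longrightarrow> (\<lambda>x. f x - t) \<in> Bd M"
  by (rule Bd_continuous[where \<phi> = "\<lambda>s. s - t"]) (auto intro!: continuous_intros)

lemma Bd_spow: "f \<in> Bd M \<Longrightarrow> 0 < k \<Longrightarrow> (\<lambda>x. spow k (f x)) \<in> Bd M"
  by (rule Bd_continuous) (auto intro!: continuous_on_spow)

text \<open>\<open>spow (1 / k)\<close> inverts \<open>spow k\<close>, so a constant signed power
  would force \<open>f\<close> to be constant.\<close>

lemma nonconstant_spow:
  assumes "\<not> f constant_on S" "k \<noteq> 0"
  shows "\<not> (\<lambda>x. spow k (f x - u)) constant_on S"
proof
  assume "(\<lambda>x. spow k (f x - u)) constant_on S"
  then obtain c where "\<And>x. x \<in> S \<Longrightarrow> spow k (f x - u) = c" by (auto simp: constant_on_def)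
  then have "f x = spow (1 / k) c + u" if "x \<in> S" for x
    using assms(2) that spow_spow[of "1 / k" k "f x - u"] by auto
  then show False using assms(1) by (auto simp: constant_on_def)
qed

section \<open>Energy and degree-weighted mass on a graphon\<close>

locale graphon_space = finite_measure M for M :: "'a measure" +
  fixes W :: "'a \<Rightarrow> 'a \<Rightarrow> real"
  assumes graphon: "graphon M W"
begin

sublocale P: pair_sigma_finite M M ..

sublocale PF: finite_measure "M \<Otimes>\<^sub>M M"
  by (rule finite_measure_pair_measure) unfold_locales

text \<open>The \<open>p\<close>-th power of \<open>Phi\<close> for finite \<open>p\<close>. Like
  \<open>mass\<close> for \<open>deg_norm\<close>, it omits the outer root, so that comparisons can
  be made under the integral.\<close>

definition energy :: "real \<Rightarrow> ('a \<Rightarrow> real) \<Rightarrow> real" where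
  "energy p f = (LINT x|M. LINT y|M. W x y * \<bar>f x - f y\<bar> powr p)"

definition mass :: "real \<Rightarrow> ('a \<Rightarrow> real) \<Rightarrow> real" where
  "mass p f = (LINT x|M. deg M W x * \<bar>f x\<bar> powr p)"

definition mass_dist :: "real \<Rightarrow> ('a \<Rightarrow> real) \<Rightarrow> real" where
  "mass_dist p f = (INF t. mass p (\<lambda>x. f x - t))"

lemma W_measurable [measurable]: "case_prod W \<in> borel_measurable (M \<Otimes>\<^sub>M M)"
  using graphon by (simp add: graphon_def)

lemma W_sym: "x \<in> space M \<Longrightarrow> y \<in> space M \<Longrightarrow> W x y = W y x"
  and W_nonneg: "x \<in> space M \<Longrightarrow> y \<in> space M \<Longrightarrow> 0 \<le> W x y"
  and W_le_1: "x \<in> space M \<Longrightarrow> y \<in> space M \<Longrightarrow> W x y \<le> 1"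
  using graphon by (auto simp: graphon_def)

lemma deg_nonneg: "x \<in> space M \<Longrightarrow> 0 \<le> deg M W x"
  unfolding deg_def by (intro Bochner_Integration.integral_nonneg W_nonneg)

lemma deg_measurable [measurable]: "deg M W \<in> borel_measurable M"
  unfolding deg_def[abs_def] by measurable

lemma integrable_W:
  assumes [measurable]: "case_prod H \<in> borel_measurable (M \<Otimes>\<^sub>M M)"
    and "\<And>x y. x \<in> space M \<Longrightarrow> y \<in> space M \<Longrightarrow> \<bar>H x y\<bar> \<le> C"
  shows "integrable (M \<Otimes>\<^sub>M M) (\<lambda>(x, y). W x y * H x y)"
proof (rule PF.integrable_const_bound[where B = C])
  have "\<bar>W x y * H x y\<bar> \<le> C" if "x \<in> space M" "y \<in> space M" for x y
    using mult_mono[of "\<bar>W x y\<bar>" 1 "\<bar>H x y\<bar>" C] W_nonneg[OF that] W_le_1[OF that] assms(2)[OF that]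
    by (simp add: abs_mult)
  then show "AE z in M \<Otimes>\<^sub>M M. norm (case z of (x, y) \<Rightarrow> W x y * H x y) \<le> C"
    by (intro AE_I2) (auto simp: space_pair_measure)
qed measurable

lemma
  assumes h: "h \<in> Bd M"
  shows integrable_W_fst: "integrable (M \<Otimes>\<^sub>M M) (\<lambda>(x, y). W x y * h x)"
    and integrable_W_snd: "integrable (M \<Otimes>\<^sub>M M) (\<lambda>(x, y). W x y * h y)"
proof -
  note [measurable] = Bd_measurable[OF h]
  obtain C where "\<And>x. x \<in> space M \<Longrightarrow> \<bar>h x\<bar> \<le> C" using BdE[OF h] by blast
  then show "integrable (M \<Otimes>\<^sub>M M) (\<lambda>(x, y). W x y * h x)"
    "integrable (M \<Otimes>\<^sub>M M) (\<lambda>(x, y). W x y * h y)"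
    by (auto intro!: integrable_W)
qed

lemma integrable_deg: "h \<in> Bd M \<Longrightarrow> integrable M (\<lambda>x. deg M W x * h x)"
  using P.integrable_fst[OF integrable_W_fst] by (simp add: deg_def)

text \<open>Both marginals of the measure with density \<open>W\<close> have density
  \<open>deg M W\<close>: Fubini's theorem gives the first, and symmetry of \<open>W\<close> the
  second.\<close>

lemma
  assumes h: "h \<in> Bd M"
  shows integral_deg_fst: "(LINT (x, y)|(M \<Otimes>\<^sub>M M). W x y * h x) = (LINT x|M. deg M W x * h x)"
    and integral_deg_snd: "(LINT (x, y)|(M \<Otimes>\<^sub>M M). W x y * h y) = (LINT x|M. deg M W x * h x)"
proof -
  show "(LINT (x, y)|(M \<Otimes>\<^sub>M M). W x y * h x) = (LINT x|M. deg M W x * h x)"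
    using P.integral_fst[OF integrable_W_fst[OF h]] by (simp add: deg_def)
  have "(LINT (x, y)|(M \<Otimes>\<^sub>M M). W x y * h y) = (LINT y|M. LINT x|M. W x y * h y)"
    using P.integral_snd[OF integrable_W_snd[OF h]] by simp
  also have "\<dots> = (LINT y|M. LINT x|M. W y x * h y)"
    by (intro Bochner_Integration.integral_cong refl) (simp add: W_sym)
  finally show "(LINT (x, y)|(M \<Otimes>\<^sub>M M). W x y * h y) = (LINT x|M. deg M W x * h x)"
    by (simp add: deg_def)
qed

lemma integrable_energy:
  assumes f: "f \<in> Bd M" and p: "1 \<le> p"
  shows "integrable (M \<Otimes>\<^sub>M M) (\<lambda>(x, y). W x y * \<bar>f x - f y\<bar> powr p)"
proof -
  note [measurable] = Bd_measurable[OF f]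
  obtain C where C: "\<And>x. x \<in> space M \<Longrightarrow> \<bar>f x\<bar> \<le> C" using BdE[OF f] by blast
  show ?thesis
  proof (rule integrable_W[where C = "(2 * C) powr p"])
    show "\<bar>\<bar>f x - f y\<bar> powr p\<bar> \<le> (2 * C) powr p" if "x \<in> space M" "y \<in> space M" for x y
      using C[OF that(1)] C[OF that(2)] p by (auto intro!: powr_mono2)
  qed measurable
qed

lemma energy_eq:
  "f \<in> Bd M \<Longrightarrow> 1 \<le> p \<Longrightarrow> energy p f = (LINT (x, y)|(M \<Otimes>\<^sub>M M). W x y * \<bar>f x - f y\<bar> powr p)"
  unfolding energy_def by (rule P.integral_fst[OF integrable_energy])

lemma energy_nonneg: "0 \<le> energy p f"
  unfolding energy_def using W_nonneg by (intro Bochner_Integration.integral_nonneg) auto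

lemma mass_nonneg: "0 \<le> mass p f"
  unfolding mass_def using deg_nonneg by (intro Bochner_Integration.integral_nonneg) auto

lemma mass_dist_le: "mass_dist p f \<le> mass p (\<lambda>x. f x - t)"
  unfolding mass_dist_def using mass_nonneg by (intro cINF_lower bdd_belowI[of _ 0]) auto

lemma mass_dist_eq:
  assumes "\<And>t. mass p f \<le> mass p (\<lambda>x. f x - t)"
  shows "mass_dist p f = mass p f"
  using mass_dist_le[of p f 0] assms unfolding mass_dist_def
  by (auto intro!: antisym cINF_greatest)

lemma mass_mono:
  assumes "f \<in> Bd M" "g \<in> Bd M" "1 \<le> p" "\<And>x. x \<in> space M \<Longrightarrow> \<bar>f x\<bar> \<le> \<bar>g x\<bar>"
  shows "mass p f \<le> mass p g"
  unfolding mass_def using assms deg_nonneg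
  by (intro integral_mono integrable_deg Bd_powr mult_left_mono powr_mono2) auto

text \<open>An instance of \<open>exists_centre\<close>: the mass of
  \<open>spow k (f x - u) - t\<close> is continuous in \<open>u\<close> by dominated convergence and
  convex in \<open>t\<close>. Shifts by \<open>- C\<close> and \<open>C\<close> make the function
  nonnegative and nonpositive, which gives the two one-sided conditions.\<close>

lemma mass_centre:
  assumes f: "f \<in> Bd M" and p: "1 \<le> p" and k: "0 < k"
  obtains u where "mass_dist p (\<lambda>x. spow k (f x - u)) = mass p (\<lambda>x. spow k (f x - u))"
proof -
  note [measurable] = Bd_measurable[OF f]
  obtain C where C: "0 \<le> C" "\<And>x. x \<in> space M \<Longrightarrow> \<bar>f x\<bar> \<le> C" using BdE[OF f] by blast
  have Bd: "(\<lambda>x. spow k (f x - u)) \<in> Bd M" for u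
    using f k by (intro Bd_spow Bd_diff_const)
  let ?h = "\<lambda>u t. mass p (\<lambda>x. spow k (f x - u) - t)"
  obtain u where u: "\<And>t. ?h u 0 \<le> ?h u t"
  proof (rule exists_centre[of ?h])
    fix t
    show "continuous_on UNIV (\<lambda>u. ?h u t)"
      unfolding continuous_on_sequentially comp_def
    proof (intro allI ballI impI, elim conjE)
      fix X :: "nat \<Rightarrow> real" and a assume X: "X \<longlonglongrightarrow> a"
      obtain K where K: "\<And>n. \<bar>X n\<bar> \<le> K"
        using convergent_imp_Bseq[OF convergentI[OF X]] by (auto simp: Bseq_def)
      \<comment> \<open>A bound uniform in \<open>n\<close> for the \<open>p\<close>-th power:
        \<open>K\<close> bounds the convergent sequence \<open>X\<close> and \<open>C\<close> bounds
        \<open>f\<close>.\<close>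
      define D where "D = ((C + K) powr k + \<bar>t\<bar>) powr p"
      show "(\<lambda>n. ?h (X n) t) \<longlonglongrightarrow> ?h a t"
        unfolding mass_def
      proof (rule integral_dominated_convergence[where w = "\<lambda>x. deg M W x * D"])
        show "integrable M (\<lambda>x. deg M W x * D)"
          by (intro integrable_deg BdI[of _ _ "\<bar>D\<bar>"]) auto
        have "continuous_on UNIV (\<lambda>u. deg M W x * \<bar>spow k (f x - u) - t\<bar> powr p)" for x
          using p k by (auto intro!: continuous_intros continuous_on_powr' continuous_on_spow)
        then show "AE x in M. (\<lambda>n. deg M W x * \<bar>spow k (f x - X n) - t\<bar> powr p)
            \<longlonglongrightarrow> deg M W x * \<bar>spow k (f x - a) - t\<bar> powr p"
          using X by (intro AE_I2) (auto simp: continuous_on_sequentially comp_def)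
        show "AE x in M. norm (deg M W x * \<bar>spow k (f x - X n) - t\<bar> powr p) \<le> deg M W x * D" for n
        proof (rule AE_I2)
          fix x assume x: "x \<in> space M"
          have "\<bar>spow k (f x - X n) - t\<bar> \<le> \<bar>f x - X n\<bar> powr k + \<bar>t\<bar>"
            using abs_triangle_ineq4[of "spow k (f x - X n)" t] by (simp add: abs_spow)
          also have "\<bar>f x - X n\<bar> powr k \<le> (C + K) powr k"
            using C(2)[OF x] K[of n] k by (intro powr_mono2) auto
          finally have "\<bar>spow k (f x - X n) - t\<bar> powr p \<le> D"
            unfolding D_def using p by (intro powr_mono2) auto
          then show "norm (deg M W x * \<bar>spow k (f x - X n) - t\<bar> powr p) \<le> deg M W x * D"
            using deg_nonneg[OF x] by (simp add: abs_mult mult_left_mono)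
        qed
      qed measurable
    qed
  next
    fix u
    note int = integrable_deg[OF Bd_powr[OF Bd_diff_const[OF Bd[of u]] p]]
    show "convex_on UNIV (?h u)"
    proof (rule convex_onI)
      fix l s t :: real assume l: "0 < l" "l < 1"
      have "?h u ((1 - l) *\<^sub>R s + l *\<^sub>R t)
          \<le> (LINT x|M. (1 - l) * (deg M W x * \<bar>spow k (f x - u) - s\<bar> powr p)
              + l * (deg M W x * \<bar>spow k (f x - u) - t\<bar> powr p))"
        unfolding mass_def
      proof (rule integral_mono)
        fix x assume x: "x \<in> space M"
        let ?v = "spow k (f x - u)"
        have "?v - ((1 - l) *\<^sub>R s + l *\<^sub>R t) = (1 - l) * (?v - s) + l * (?v - t)"
          by (simp add: algebra_simps)
        then have "\<bar>?v - ((1 - l) *\<^sub>R s + l *\<^sub>R t)\<bar> powr p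
            \<le> (1 - l) * \<bar>?v - s\<bar> powr p + l * \<bar>?v - t\<bar> powr p"
          using convex_onD[OF convex_on_abs_powr[OF p], of l "?v - s" "?v - t"] l by simp
        then show "deg M W x * \<bar>?v - ((1 - l) *\<^sub>R s + l *\<^sub>R t)\<bar> powr p
            \<le> (1 - l) * (deg M W x * \<bar>?v - s\<bar> powr p) + l * (deg M W x * \<bar>?v - t\<bar> powr p)"
          using mult_left_mono[OF _ deg_nonneg[OF x]] by (fastforce simp: algebra_simps)
      qed (auto intro!: int)
      also have "\<dots> = (1 - l) * ?h u s + l * ?h u t"
        unfolding mass_def using int by simp
      finally show "?h u ((1 - l) *\<^sub>R s + l *\<^sub>R t) \<le> (1 - l) * ?h u s + l * ?h u t" .
    qed simp
  next
    \<comment> \<open>Subtracting some \<open>t \<le> 0\<close> from a nonnegative function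
      increases its absolute value pointwise, hence its mass.\<close>
    have "0 \<le> spow k (f x - (- C))" if "x \<in> space M" for x
      using C(2)[OF that] by (intro spow_nonneg) auto
    then show "\<exists>u. \<forall>t\<le>0. ?h u 0 \<le> ?h u t"
      by (intro exI[of _ "- C"] allI impI mass_mono Bd_diff_const Bd p) fastforce
    have "spow k (f x - C) \<le> 0" if "x \<in> space M" for x
      using C(2)[OF that] by (intro spow_nonpos) auto
    then show "\<exists>u. \<forall>t\<ge>0. ?h u 0 \<le> ?h u t"
      by (intro exI[of _ C] allI impI mass_mono Bd_diff_const Bd p) fastforce
  qed (rule that)
  then show ?thesis
    by (intro that[of u] mass_dist_eq) simp
qed

section \<open>How signed powers change mass and energy\<close>

lemma mass_spow: "mass p (\<lambda>x. spow k (f x)) = mass (p * k) f"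
  by (simp add: mass_def abs_spow powr_powr mult.commute)

text \<open>\<open>abs_diff_powr_le_spow\<close> is applied to the values of
  \<open>spow (1 / r)\<close>, which \<open>spow r\<close> undoes. The shift \<open>u\<close>
  cancels in the difference; raising to the power \<open>p\<close> and integrating against
  \<open>W\<close> finishes.\<close>

lemma energy_root_le:
  assumes f: "f \<in> Bd M" and p: "1 \<le> p" and r: "1 \<le> r"
  shows "energy (p * r) (\<lambda>x. spow (1 / r) (f x - u)) \<le> (2 powr (r - 1)) powr p * energy p f"
proof -
  let ?g = "\<lambda>x. spow (1 / r) (f x - u)"
  have pr: "1 \<le> p * r" using p r mult_mono[of 1 p 1 r] by simp
  have g: "?g \<in> Bd M" using f r by (intro Bd_spow Bd_diff_const) auto
  have "energy (p * r) ?g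
      \<le> (LINT z|(M \<Otimes>\<^sub>M M). (2 powr (r - 1)) powr p * (case z of (x, y) \<Rightarrow> W x y * \<bar>f x - f y\<bar> powr p))"
    unfolding energy_eq[OF g pr]
  proof (intro integral_mono integrable_energy g pr integrable_mult_right f p)
    fix z assume z: "z \<in> space (M \<Otimes>\<^sub>M M)"
    obtain x y where xy: "z = (x, y)" "x \<in> space M" "y \<in> space M"
      using z by (auto simp: space_pair_measure)
    have "\<bar>?g x - ?g y\<bar> powr r \<le> 2 powr (r - 1) * \<bar>f x - f y\<bar>"
      using abs_diff_powr_le_spow[OF r, of "?g x" "?g y"] r by (simp add: spow_spow)
    then have "(\<bar>?g x - ?g y\<bar> powr r) powr p \<le> (2 powr (r - 1) * \<bar>f x - f y\<bar>) powr p"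
      using p by (intro powr_mono2) auto
    then have "\<bar>?g x - ?g y\<bar> powr (p * r) \<le> (2 powr (r - 1)) powr p * \<bar>f x - f y\<bar> powr p"
      by (simp add: powr_powr powr_mult mult.commute)
    then show "(case z of (x, y) \<Rightarrow> W x y * \<bar>?g x - ?g y\<bar> powr (p * r))
        \<le> (2 powr (r - 1)) powr p * (case z of (x, y) \<Rightarrow> W x y * \<bar>f x - f y\<bar> powr p)"
      using mult_left_mono[OF _ W_nonneg[OF xy(2,3)]] xy(1) by (fastforce simp: mult_ac)
  qed
  then show ?thesis by (simp add: energy_eq[OF f p])
qed

text \<open>Hoelder's inequality applied to the integrated bound
  \<open>abs_spow_diff_powr_le\<close>. The endpoint average in that bound integrates to exactly the
  mass, because both marginals of \<open>W\<close> are the degree.\<close>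

lemma energy_power_le:
  assumes f: "f \<in> Bd M" and p: "1 \<le> p" and r: "1 \<le> r"
  shows "energy p (\<lambda>x. spow r (f x - u))
    \<le> r powr p * (energy (p * r) f powr (1 / r) * mass (p * r) (\<lambda>x. f x - u) powr (1 - 1 / r))"
proof -
  let ?g = "\<lambda>x. spow r (f x - u)" and ?q = "p * r" and ?P = "M \<Otimes>\<^sub>M M"
  let ?a = "\<lambda>x. \<bar>f x - u\<bar> powr ?q"
  have q: "1 \<le> ?q" using p r mult_mono[of 1 p 1 r] by simp
  have g: "?g \<in> Bd M" using f r by (intro Bd_spow Bd_diff_const) auto
  have a: "?a \<in> Bd M" by (intro Bd_powr Bd_diff_const f q)
  define A where "A = (\<lambda>(x, y). W x y * \<bar>f x - f y\<bar> powr ?q)"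
  define V where "V = (\<lambda>(x, y). W x y * ((?a x + ?a y) / 2))"
  have intA: "integrable ?P A" unfolding A_def by (rule integrable_energy[OF f q])
  have V_eq: "V = (\<lambda>z. ((case z of (x, y) \<Rightarrow> W x y * ?a x) + (case z of (x, y) \<Rightarrow> W x y * ?a y)) / 2)"
    by (auto simp: V_def fun_eq_iff field_simps)
  have intV: "integrable ?P V"
    unfolding V_eq using Bochner_Integration.integrable_add[OF integrable_W_fst[OF a] integrable_W_snd[OF a]]
    by (rule integrable_divide)
  have "integral\<^sup>L ?P V
      = ((LINT (x, y)|?P. W x y * ?a x) + (LINT (x, y)|?P. W x y * ?a y)) / 2"
    unfolding V_eq using integrable_W_fst[OF a] integrable_W_snd[OF a] by simp
  also have "\<dots> = mass ?q (\<lambda>x. f x - u)"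
    unfolding integral_deg_fst[OF a] integral_deg_snd[OF a] by (simp add: mass_def)
  finally have V: "integral\<^sup>L ?P V = mass ?q (\<lambda>x. f x - u)" .
  have nn: "0 \<le> A z" "0 \<le> V z" if "z \<in> space ?P" for z
    using that W_nonneg by (auto simp: A_def V_def space_pair_measure)
  have "energy p ?g \<le> (LINT z|?P. r powr p * (A z powr (1 / r) * V z powr (1 - 1 / r)))"
    unfolding energy_eq[OF g p]
  proof (rule integral_mono)
    fix z assume "z \<in> space ?P"
    then obtain x y where xy: "z = (x, y)" "x \<in> space M" "y \<in> space M"
      by (auto simp: space_pair_measure)
    have "W x y * \<bar>?g x - ?g y\<bar> powr p
        \<le> W x y * (r powr p * ((\<bar>f x - f y\<bar> powr ?q) powr (1 / r) * ((?a x + ?a y) / 2) powr (1 - 1 / r)))"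
      using abs_spow_diff_powr_le[OF r p, of "f x - u" "f y - u"] W_nonneg[OF xy(2,3)]
      by (intro mult_left_mono) simp_all
    \<comment> \<open>The weight is split as \<open>W powr (1 / r) * W powr (1 - 1 / r)\<close>, one
      factor for \<open>A\<close> and one for \<open>V\<close>.\<close>
    also have "\<dots> = r powr p * (W x y powr (1 / r + (1 - 1 / r)) *
        ((\<bar>f x - f y\<bar> powr ?q) powr (1 / r) * ((?a x + ?a y) / 2) powr (1 - 1 / r)))"
      using W_nonneg[OF xy(2,3)] by simp
    also have "\<dots> = r powr p * (A z powr (1 / r) * V z powr (1 - 1 / r))"
      unfolding A_def V_def xy(1) prod.case powr_mult powr_add by (simp only: mult_ac)
    finally show "(case z of (x, y) \<Rightarrow> W x y * \<bar>?g x - ?g y\<bar> powr p)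
        \<le> r powr p * (A z powr (1 / r) * V z powr (1 - 1 / r))"
      by (simp add: xy(1))
  next
    show "integrable ?P (\<lambda>z. r powr p * (A z powr (1 / r) * V z powr (1 - 1 / r)))"
    proof (rule integrable_mult_right, rule Bochner_Integration.integrable_bound)
      \<comment> \<open>Young's inequality dominates the product by this convex combination of
        integrable functions.\<close>
      show "integrable ?P (\<lambda>z. 1 / r * A z + (1 - 1 / r) * V z)"
        using intA intV by simp
      show "(\<lambda>z. A z powr (1 / r) * V z powr (1 - 1 / r)) \<in> borel_measurable ?P"
        using intA intV by measurable
      show "AE z in ?P. norm (A z powr (1 / r) * V z powr (1 - 1 / r))
          \<le> norm (1 / r * A z + (1 - 1 / r) * V z)"
      proof (rule AE_I2)
        fix z assume "z \<in> space ?P"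
        note nn = nn[OF this]
        have "A z powr (1 / r) * V z powr (1 - 1 / r) \<le> 1 / r * A z + (1 - 1 / r) * V z"
        proof (cases "A z = 0 \<or> V z = 0")
          case False
          then show ?thesis using r nn by (intro Youngs_inequality_0) auto
        qed (use r nn in auto)
        then show "norm (A z powr (1 / r) * V z powr (1 - 1 / r))
            \<le> norm (1 / r * A z + (1 - 1 / r) * V z)"
          by (simp add: abs_mult)
      qed
    qed
  qed (rule integrable_energy[OF g p])
  also have "\<dots> = r powr p * (LINT z|?P. A z powr (1 / r) * V z powr (1 - 1 / r))"
    by simp
  also have "\<dots> \<le> r powr p * (integral\<^sup>L ?P A powr (1 / r) * integral\<^sup>L ?P V powr (1 - 1 / r))"
    using intA intV nn r by (intro mult_left_mono integral_geometric_mean_le) auto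
  also have "integral\<^sup>L ?P A = energy ?q f"
    unfolding A_def by (rule energy_eq[OF f q, symmetric])
  finally show ?thesis unfolding V .
qed

section \<open>The two inequalities for finite exponents\<close>

lemma c2_eq:
  assumes "1 \<le> p"
  shows "c2 M (Phi M W (ennreal p)) (deg_norm M W (ennreal p)) =
    (INF f\<in>{f \<in> Bd M. \<not> f constant_on space M \<and> 0 < mass_dist p f}.
       ennreal ((energy p f / mass_dist p f) powr (1 / p)))"
  using c2_Phi_deg_norm[OF graphon assms] by (simp add: energy_def mass_dist_def mass_def)

lemma c2_finite_lower:
  assumes p: "1 \<le> p" and r: "1 \<le> r"
  shows "ennreal (2 powr (1 - r)) *
      ennreal_powr (c2 M (Phi M W (ennreal (p * r))) (deg_norm M W (ennreal (p * r)))) r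
    \<le> c2 M (Phi M W (ennreal p)) (deg_norm M W (ennreal p))" (is "_ * ennreal_powr ?c r \<le> _")
  unfolding c2_eq[OF p]
proof (rule INF_greatest, clarify)
  fix f assume f: "f \<in> Bd M" "\<not> f constant_on space M" and D: "0 < mass_dist p f"
  have q: "1 \<le> p * r" using p r mult_mono[of 1 p 1 r] by simp
  obtain u where u: "mass_dist (p * r) (\<lambda>x. spow (1 / r) (f x - u)) =
      mass (p * r) (\<lambda>x. spow (1 / r) (f x - u))"
    using mass_centre[OF f(1) q, of "1 / r"] r by auto
  let ?g = "\<lambda>x. spow (1 / r) (f x - u)"
  \<comment> \<open>By centring, the distance of \<open>?g\<close> equals the mass of
    \<open>f - u\<close>, which is at least the distance of \<open>f\<close>; in particular
    \<open>?g\<close> is admissible.\<close>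
  have Dg: "mass_dist p f \<le> mass_dist (p * r) ?g"
    unfolding u mass_spow using r mass_dist_le[of p f u] by simp
  have "?g \<in> Bd M" "\<not> ?g constant_on space M"
    using f r by (auto intro!: Bd_spow Bd_diff_const simp: nonconstant_spow)
  then have "?c \<le> ennreal ((energy (p * r) ?g / mass_dist (p * r) ?g) powr (1 / (p * r)))"
    (is "_ \<le> ennreal ?b")
    unfolding c2_eq[OF q] using D Dg by (intro INF_lower) auto
  \<comment> \<open>\<open>?c\<close> lies below a real number and is therefore finite, so
    \<open>ennreal_powr\<close> acts on it as the real power.\<close>
  then have c: "ennreal_powr ?c r \<le> ennreal (?b powr r)"
    using r by (cases ?c) (auto simp: ennreal_powr_def top_unique intro!: ennreal_leI powr_mono2)
  have "?b powr r = (energy (p * r) ?g / mass_dist (p * r) ?g) powr (1 / p)"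
    using r by (simp add: powr_powr)
  also have "\<dots> \<le> ((2 powr (r - 1)) powr p * (energy p f / mass_dist p f)) powr (1 / p)"
    using frac_le[OF _ energy_root_le[OF f(1) p r, of u] D Dg] p D Dg
      energy_nonneg[of "p * r" ?g] energy_nonneg[of p f]
    by (intro powr_mono2) auto
  also have "\<dots> = 2 powr (r - 1) * (energy p f / mass_dist p f) powr (1 / p)"
    unfolding powr_mult powr_powr using p by simp
  finally have "ennreal_powr ?c r
      \<le> ennreal (2 powr (r - 1) * (energy p f / mass_dist p f) powr (1 / p))"
    by (rule order_trans[OF c ennreal_leI])
  then have "ennreal (2 powr (1 - r)) * ennreal_powr ?c r
      \<le> ennreal (2 powr (1 - r)) * ennreal (2 powr (r - 1) * (energy p f / mass_dist p f) powr (1 / p))"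
    by (rule mult_left_mono) simp
  also have "\<dots> = ennreal ((2 powr (1 - r) * 2 powr (r - 1)) * (energy p f / mass_dist p f) powr (1 / p))"
    by (simp add: ennreal_mult' mult.assoc)
  also have "2 powr (1 - r) * 2 powr (r - 1) = (1::real)"
    by (simp flip: powr_add)
  finally show "ennreal (2 powr (1 - r)) * ennreal_powr ?c r
      \<le> ennreal ((energy p f / mass_dist p f) powr (1 / p))" by simp
qed

lemma c2_finite_upper:
  assumes p: "1 \<le> p" and r: "1 \<le> r"
  shows "c2 M (Phi M W (ennreal p)) (deg_norm M W (ennreal p))
    \<le> ennreal r * c2 M (Phi M W (ennreal (p * r))) (deg_norm M W (ennreal (p * r)))"
    (is "?c \<le> _")
proof -
  have q: "1 \<le> p * r" using p r mult_mono[of 1 p 1 r] by simp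
  \<comment> \<open>With \<open>r\<close> moved to the left, the right side is a plain infimum, and
    each test function can be treated separately.\<close>
  have "?c / ennreal r \<le> c2 M (Phi M W (ennreal (p * r))) (deg_norm M W (ennreal (p * r)))"
    unfolding c2_eq[OF q]
  proof (rule INF_greatest, clarify)
    fix f assume f: "f \<in> Bd M" "\<not> f constant_on space M" and D: "0 < mass_dist (p * r) f"
    obtain u where u: "mass_dist p (\<lambda>x. spow r (f x - u)) = mass p (\<lambda>x. spow r (f x - u))"
      using mass_centre[OF f(1) p, of r] r by auto
    let ?g = "\<lambda>x. spow r (f x - u)"
    define X where "X = mass (p * r) (\<lambda>x. f x - u)"
    have Dg: "mass_dist p ?g = X" unfolding u mass_spow X_def ..
    have X: "mass_dist (p * r) f \<le> X" unfolding X_def by (rule mass_dist_le)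
    let ?E = "energy (p * r) f"
    have "?g \<in> Bd M" "\<not> ?g constant_on space M"
      using f r by (auto intro!: Bd_spow Bd_diff_const simp: nonconstant_spow)
    then have c: "?c \<le> ennreal ((energy p ?g / X) powr (1 / p))"
      unfolding c2_eq[OF p] using D X Dg by (intro INF_lower2[of ?g]) auto
    have "energy p ?g / X \<le> r powr p * (?E powr (1 / r) * X powr (1 - 1 / r)) / X"
      unfolding X_def by (intro divide_right_mono energy_power_le f p r mass_nonneg)
    \<comment> \<open>The powers of \<open>X\<close> combine to \<open>X powr (- 1 / r)\<close>;
      this is homogeneous with the energy factor, and \<open>X\<close> can then be replaced by the
      smaller distance of \<open>f\<close>.\<close>
    also have "\<dots> = r powr p * (?E / X) powr (1 / r)"
      using D X by (simp add: powr_diff powr_divide)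
    also have "\<dots> \<le> r powr p * (?E / mass_dist (p * r) f) powr (1 / r)"
      using D X r energy_nonneg[of "p * r" f]
      by (intro mult_left_mono powr_mono2 divide_left_mono) auto
    finally have "(energy p ?g / X) powr (1 / p)
        \<le> (r powr p * (?E / mass_dist (p * r) f) powr (1 / r)) powr (1 / p)"
      using p D X energy_nonneg[of p ?g] by (intro powr_mono2) auto
    with c have "?c \<le> ennreal ((r powr p * (?E / mass_dist (p * r) f) powr (1 / r)) powr (1 / p))"
      by (rule order_trans[OF _ ennreal_leI])
    also have "(r powr p * (?E / mass_dist (p * r) f) powr (1 / r)) powr (1 / p)
        = r * (?E / mass_dist (p * r) f) powr (1 / (p * r))"
      using p r by (simp add: powr_mult powr_powr mult.commute)
    finally show "?c / ennreal r \<le> ennreal ((?E / mass_dist (p * r) f) powr (1 / (p * r)))"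
      using r by (intro divide_le_posI_ennreal) (auto simp: ennreal_mult' mult.commute)
  qed
  then have "ennreal r * (?c / ennreal r)
      \<le> ennreal r * c2 M (Phi M W (ennreal (p * r))) (deg_norm M W (ennreal (p * r)))"
    by (rule mult_left_mono) simp
  moreover have "ennreal r * (?c / ennreal r) = ?c"
    using r by (simp add: ennreal_times_divide mult_divide_eq_ennreal mult.commute[of "ennreal r"])
  ultimately show ?thesis by simp
qed

section \<open>The exponent infinity\<close>

lemma Phi_infinity_le:
  assumes f: "f \<in> Bd M"
  shows "Phi M W \<infinity> f \<le> 2 * deg_norm M W \<infinity> (\<lambda>x. f x - t)"
proof -
  note [measurable] = Bd_measurable[OF f]
  let ?P = "M \<Otimes>\<^sub>M M" and ?\<mu> = "density M (\<lambda>x. ennreal (deg M W x))"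
  define s where "s = esssup ?\<mu> (\<lambda>x. ennreal \<bar>f x - t\<bar>)"
  define n where "n = enn2real s"
  obtain C where C: "0 \<le> C" "\<And>x. x \<in> space M \<Longrightarrow> \<bar>f x - t\<bar> \<le> C"
    using BdE[OF Bd_diff_const[OF f]] by blast
  \<comment> \<open>Boundedness of \<open>f\<close> makes the essential supremum finite, so
    \<open>enn2real\<close> loses no information.\<close>
  have "s \<le> ennreal C"
    unfolding s_def by (rule esssup_I) (auto simp: AE_density intro!: AE_I2 ennreal_leI C)
  then have "s = ennreal n" unfolding n_def by (cases s) (auto simp: top_unique)
  then have "AE x in ?\<mu>. ennreal \<bar>f x - t\<bar> \<le> ennreal n"
    using esssup_AE[of "\<lambda>x. ennreal \<bar>f x - t\<bar>" ?\<mu>] by (simp add: s_def)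
  then have AE: "AE x in M. 0 < deg M W x \<longrightarrow> \<bar>f x - t\<bar> \<le> n"
    by (auto simp: AE_density n_def ennreal_le_iff elim: eventually_mono)
  \<comment> \<open>The exceptional set of the essential bound. It is null for the degree measure,
    so the strips \<open>S\<close> times the space and the space times \<open>S\<close> are null for
    the measure with density \<open>W\<close>; outside them the triangle inequality through
    \<open>t\<close> gives \<open>2 * n\<close>.\<close>
  define S where "S = {x \<in> space M. n < \<bar>f x - t\<bar>}"
  have [measurable]: "S \<in> sets M" unfolding S_def by measurable
  have S: "indicator S \<in> Bd M" by (rule BdI[where C = 1]) (auto simp: indicator_def)
  have "(LINT x|M. deg M W x * indicator S x) = 0"
    using AE AE_space
    by (intro integral_eq_zero_AE, eventually_elim)
      (auto simp: S_def indicator_def dest: deg_nonneg)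
  then have "(LINT (x, y)|?P. W x y * indicator S x) = 0" "(LINT (x, y)|?P. W x y * indicator S y) = 0"
    using integral_deg_fst[OF S] integral_deg_snd[OF S] by simp_all
  moreover have "AE z in ?P. 0 \<le> (case z of (x, y) \<Rightarrow> W x y * indicator S x)"
    "AE z in ?P. 0 \<le> (case z of (x, y) \<Rightarrow> W x y * indicator S y)"
    using W_nonneg by (auto intro!: AE_I2 simp: space_pair_measure)
  ultimately have "AE z in ?P. (case z of (x, y) \<Rightarrow> W x y * indicator S x) = 0"
    "AE z in ?P. (case z of (x, y) \<Rightarrow> W x y * indicator S y) = 0"
    using integral_nonneg_eq_0_iff_AE[OF integrable_W_fst[OF S]]
      integral_nonneg_eq_0_iff_AE[OF integrable_W_snd[OF S]] by auto
  then have "AE z in ?P. 0 < (case z of (x, y) \<Rightarrow> ennreal (W x y)) \<longrightarrow>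
      (case z of (x, y) \<Rightarrow> ennreal \<bar>f x - f y\<bar>) \<le> ennreal (2 * n)"
    using AE_space
    by eventually_elim
      (auto simp: S_def space_pair_measure indicator_def split: if_splits intro!: ennreal_leI)
  then have "esssup (density ?P (\<lambda>(x, y). ennreal (W x y))) (\<lambda>(x, y). ennreal \<bar>f x - f y\<bar>) \<le> ennreal (2 * n)"
    by (intro esssup_I) (auto simp: AE_density)
  then have "Phi M W \<infinity> f \<le> 2 * n"
    unfolding Phi_def by (auto simp: n_def intro!: enn2real_leI)
  then show ?thesis by (simp add: deg_norm_def n_def s_def)
qed

text \<open>Each admissible \<open>f\<close> has quotient at most \<open>2\<close>, by taking the
  infimum over \<open>t\<close> in \<open>Phi_infinity_le\<close>. The alternative is the infimum of
  the empty set.\<close>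

lemma c2_infinity:
  "c2 M (Phi M W \<infinity>) (deg_norm M W \<infinity>) \<le> 2 \<or> c2 M (Phi M W \<infinity>) (deg_norm M W \<infinity>) = \<infinity>"
proof (cases "{f \<in> Bd M. \<not> f constant_on space M \<and> 0 < dist_const (deg_norm M W \<infinity>) f} = {}")
  case False
  then obtain f where f: "f \<in> Bd M" "\<not> f constant_on space M"
    and D: "0 < dist_const (deg_norm M W \<infinity>) f" by auto
  have "Phi M W \<infinity> f / 2 \<le> dist_const (deg_norm M W \<infinity>) f"
    unfolding dist_const_def using Phi_infinity_le[OF f(1)] by (intro cINF_greatest) (auto simp: mult.commute)
  then have "ennreal (Phi M W \<infinity> f / dist_const (deg_norm M W \<infinity>) f) \<le> ennreal 2"
    using D by (intro ennreal_leI) (simp add: divide_simps)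
  then have "c2 M (Phi M W \<infinity>) (deg_norm M W \<infinity>) \<le> 2"
    unfolding c2_def using f D by (intro INF_lower2[of f]) auto
  then show ?thesis ..
qed (simp add: c2_def)

end

text \<open>For real \<open>x \<le> 2\<close> the left side is \<open>2 * (x / 2) powr r\<close>,
  and a power \<open>r \<ge> 1\<close> does not increase a number in the unit interval.\<close>

lemma two_powr_mult_ennreal_powr_le:
  assumes "c \<le> 2 \<or> c = \<infinity>" "1 \<le> r"
  shows "ennreal (2 powr (1 - r)) * ennreal_powr c r \<le> c"
proof (cases c)
  case (real x)
  then have x: "0 \<le> x" "x \<le> 2" using assms(1) by (auto simp flip: ennreal_numeral)
  have "2 powr (1 - r) * x powr r = 2 * (x / 2) powr r"
    by (simp add: powr_diff powr_divide)
  also have "\<dots> \<le> x"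
    using x assms(2) powr_le_one_le[of "x / 2" r] by (cases "x = 0") auto
  finally show ?thesis
    using real x by (simp add: ennreal_powr_def ennreal_leI flip: ennreal_mult')
qed simp

theorem theorem5p2:
  fixes M :: "'a measure" and W :: "'a \<Rightarrow> 'a \<Rightarrow> real" and p :: ennreal and r :: real
  assumes "finite_measure M" and "0 < emeasure M (space M)"
    and "graphon M W"
    and "1 \<le> p" and "1 \<le> r"
  shows "ennreal (2 powr (1 - r)) *
           ennreal_powr (c2 M (Phi M W (p * ennreal r)) (deg_norm M W (p * ennreal r))) r
         \<le> c2 M (Phi M W p) (deg_norm M W p)
       \<and> c2 M (Phi M W p) (deg_norm M W p)
         \<le> ennreal r * c2 M (Phi M W (p * ennreal r)) (deg_norm M W (p * ennreal r))"
proof -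
  interpret graphon_space M W
    by (intro graphon_space.intro graphon_space_axioms.intro assms)
  show ?thesis
  proof (cases p)
    case (real q)
    then have "1 \<le> q" using assms(4) by (simp flip: ennreal_1)
    then show ?thesis
      using c2_finite_lower[of q r] c2_finite_upper[of q r] assms(5) real
      by (simp add: ennreal_mult')
  next
    case top
    \<comment> \<open>Both exponents are infinite, so a single constant \<open>c\<close> occurs
      throughout: the upper bound becomes \<open>c \<le> r * c\<close>, and the lower one follows
      from \<open>c2_infinity\<close>.\<close>
    then have "p * ennreal r = \<infinity>" "p = \<infinity>"
      using assms(5) by (auto simp: ennreal_top_mult)
    moreover have "c \<le> ennreal r * c" for c
      using mult_right_mono[of 1 "ennreal r" c] assms(5) by simp
    ultimately show ?thesis
      using two_powr_mult_ennreal_powr_le[OF c2_infinity assms(5)] by simp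
  qed
qed

end
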